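(* Let $\mathcal{A}$ be a (finite-dimensional left) Leibniz algebra over a field $F$, and let $I=\{\delta\in Der(\mathcal{A})\mid \mathrm{im}(\delta)\subseteq\mathrm{Leib}(\mathcal{A})\}$. If $\mathcal{A}$ is complete, then the sum $Z^l_{hol(\mathcal{A})}(\mathcal{A})+I$ is direct, $$hol(\mathcal{A})=\mathcal{A}+\bigl(Z^l_{hol(\mathcal{A})}(\mathcal{A})\oplus I\bigr),$$ and $$\mathcal{A}\cap\bigl(Z^l_{hol(\mathcal{A})}(\mathcal{A})\oplus I\bigr)=\mathrm{Leib}(\mathcal{A}).$$
   Context: All Leibniz algebras are finite-dimensional left Leibniz algebras: vector spaces $\mathcal{A}$ over a field $F$ with a bilinear product $[\,,\,]$ such that every left multiplication operator $L_x(y)=[x,y]$ is a derivation of the product, i.e. $[x,[y,z]]=[[x,y],z]+[y,[x,z]]$. A linear map $\delta:\mathcal{A}\to\mathcal{A}$ is a derivation if $\delta([x,y])=[\delta(x),y]+[x,\delta(y)]$ for all $x,y$; $Der(\mathcal{A})$ denotes the Lie algebra of all derivations (with commutator bracket). $\mathrm{Leib}(\mathcal{A})=\mathrm{span}\{[x,x]\mid x\in\mathcal{A}\}$, which is an abelian ideal, and $\mathcal{A}/\mathrm{Leib}(\mathcal{A})$ is a Lie algebra. A derivation $\delta\in Der(\mathcal{A})$ is inner if there exists $x\in\mathcal{A}$ with $\mathrm{im}(\delta-L_x)\subseteq\mathrm{Leib}(\mathcal{A})$. $\mathcal{A}$ is complete if (1) the center $Z(\mathcal{A}/\mathrm{Leib}(\mathcal{A}))$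 of the Lie algebra $\mathcal{A}/\mathrm{Leib}(\mathcal{A})$ is $\{0\}$, and (2) every derivation of $\mathcal{A}$ is inner (in the sense just defined). The holomorph of $\mathcal{A}$ is the vector space $hol(\mathcal{A})=\mathcal{A}\oplus Der(\mathcal{A})$ with product $[x+\delta_1,y+\delta_2]=[x,y]+\delta_1(y)+[L_x,\delta_2]+[\delta_1,\delta_2]$ for $x,y\in\mathcal{A}$, $\delta_1,\delta_2\in Der(\mathcal{A})$, where $[L_x,\delta_2]$ and $[\delta_1,\delta_2]$ are commutators in $Der(\mathcal{A})$; it is a Leibniz algebra, and $\mathcal{A}$ and $Der(\mathcal{A})$ are regarded as subspaces of it. For subspaces $\mathcal{M},\mathcal{L}$ of $hol(\mathcal{A})$, the left centralizer of $\mathcal{M}$ in $\mathcal{L}$ is $Z^l_{\mathcal{L}}(\mathcal{M})=\{x\in\mathcal{L}\mid[x,\mathcal{M}]=0\}$. Sums $+$ and $\oplus$ are of vector subspaces. *)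

theory Defs
  imports
    Complex_Main
    "HOL-Library.Function_Algebras"
    "HOL-Library.Product_Plus"
    "HOL-Library.Set_Algebras"
begin

section \<open>Leibniz algebras, derivations and completeness\<close>

text \<open>
  The underlying vector space is the whole type \<open>'a\<close>, with scalar multiplication \<open>scale\<close> over an
  arbitrary field \<open>'f\<close>. Linear operators are elements of \<open>'a \<Rightarrow> 'a\<close> with the pointwise operations.
\<close>

locale left_leibniz_algebra =
  fixes scale :: "'f::field \<Rightarrow> 'a::ab_group_add \<Rightarrow> 'a"
    and bracket :: "'a \<Rightarrow> 'a \<Rightarrow> 'a"
  assumes finite_dimensional: "\<exists>B. finite_dimensional_vector_space scale B"
    and linear_left: "Vector_Spaces.linear scale scale (\<lambda>x. bracket x y)"
    and linear_right: "Vector_Spaces.linear scale scale (\<lambda>y. bracket x y)"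
    and left_leibniz:
      "bracket x (bracket y z) = bracket (bracket x y) z + bracket y (bracket x z)"

definition Der :: "('f::field \<Rightarrow> 'a::ab_group_add \<Rightarrow> 'a) \<Rightarrow> ('a \<Rightarrow> 'a \<Rightarrow> 'a) \<Rightarrow> ('a \<Rightarrow> 'a) set" where
  "Der scale bracket =
     {\<delta>. Vector_Spaces.linear scale scale \<delta> \<and>
          (\<forall>x y. \<delta> (bracket x y) = bracket (\<delta> x) y + bracket x (\<delta> y))}"

definition Leib :: "('f::field \<Rightarrow> 'a::ab_group_add \<Rightarrow> 'a) \<Rightarrow> ('a \<Rightarrow> 'a \<Rightarrow> 'a) \<Rightarrow> 'a set" where
  "Leib scale bracket = module.span scale (range (\<lambda>x. bracket x x))"

definition inner_derivation ::
  "('f::field \<Rightarrow> 'a::ab_group_add \<Rightarrow> 'a) \<Rightarrow> ('a \<Rightarrow> 'a \<Rightarrow> 'a) \<Rightarrow> ('a \<Rightarrow> 'a) \<Rightarrow> bool" where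
  "inner_derivation scale bracket \<delta> \<longleftrightarrow>
     \<delta> \<in> Der scale bracket \<and> (\<exists>x. range (\<delta> - bracket x) \<subseteq> Leib scale bracket)"

text \<open>
  The elements of the quotient by \<open>Leib\<close> are the cosets \<open>x +o Leib\<close>; its zero is \<open>Leib\<close> itself.
  That the product of cosets is again a coset, is independent of representatives and is alternating
  is shown in \<open>leib_quot_bracket_coset\<close> and \<open>leib_quot_bracket_self\<close> below.
  Since the quotient is a Lie algebra, annihilating from one side suffices in the definition of its
  center.
\<close>

definition leib_quot ::
  "('f::field \<Rightarrow> 'a::ab_group_add \<Rightarrow> 'a) \<Rightarrow> ('a \<Rightarrow> 'a \<Rightarrow> 'a) \<Rightarrow> 'a set set" where
  "leib_quot scale bracket = range (\<lambda>x. x +o Leib scale bracket)"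

definition leib_quot_bracket ::
  "('f::field \<Rightarrow> 'a::ab_group_add \<Rightarrow> 'a) \<Rightarrow> ('a \<Rightarrow> 'a \<Rightarrow> 'a) \<Rightarrow> 'a set \<Rightarrow> 'a set \<Rightarrow> 'a set" where
  "leib_quot_bracket scale bracket X Y = (\<Union>x\<in>X. \<Union>y\<in>Y. bracket x y +o Leib scale bracket)"

definition leib_quot_center ::
  "('f::field \<Rightarrow> 'a::ab_group_add \<Rightarrow> 'a) \<Rightarrow> ('a \<Rightarrow> 'a \<Rightarrow> 'a) \<Rightarrow> 'a set set" where
  "leib_quot_center scale bracket =
     {X \<in> leib_quot scale bracket.
        \<forall>Y \<in> leib_quot scale bracket. leib_quot_bracket scale bracket X Y = Leib scale bracket}"

definition complete_leibniz ::
  "('f::field \<Rightarrow> 'a::ab_group_add \<Rightarrow> 'a) \<Rightarrow> ('a \<Rightarrow> 'a \<Rightarrow> 'a) \<Rightarrow> bool" where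
  "complete_leibniz scale bracket \<longleftrightarrow>
     leib_quot_center scale bracket = {Leib scale bracket} \<and>
     (\<forall>\<delta> \<in> Der scale bracket. inner_derivation scale bracket \<delta>)"


section \<open>The holomorph\<close>

text \<open>
  The element \<open>x + \<delta>\<close> of the holomorph is the pair \<open>(x, \<delta>)\<close>. Thus a subset \<open>S\<close> of the algebra,
  regarded inside the holomorph, is \<open>S \<times> {0}\<close>, and a set \<open>D\<close> of derivations is \<open>{0} \<times> D\<close>.
\<close>

definition commutator :: "('a::ab_group_add \<Rightarrow> 'a) \<Rightarrow> ('a \<Rightarrow> 'a) \<Rightarrow> 'a \<Rightarrow> 'a" where
  "commutator f g = (f \<circ> g) - (g \<circ> f)"

definition hol ::
  "('f::field \<Rightarrow> 'a::ab_group_add \<Rightarrow> 'a) \<Rightarrow> ('a \<Rightarrow> 'a \<Rightarrow> 'a) \<Rightarrow> ('a \<times> ('a \<Rightarrow> 'a)) set" where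
  "hol scale bracket = UNIV \<times> Der scale bracket"

definition hol_scale ::
  "('f::field \<Rightarrow> 'a::ab_group_add \<Rightarrow> 'a) \<Rightarrow> 'f \<Rightarrow> 'a \<times> ('a \<Rightarrow> 'a) \<Rightarrow> 'a \<times> ('a \<Rightarrow> 'a)" where
  "hol_scale scale c u = (scale c (fst u), \<lambda>y. scale c (snd u y))"

fun hol_bracket ::
  "('a::ab_group_add \<Rightarrow> 'a \<Rightarrow> 'a) \<Rightarrow> 'a \<times> ('a \<Rightarrow> 'a) \<Rightarrow> 'a \<times> ('a \<Rightarrow> 'a) \<Rightarrow> 'a \<times> ('a \<Rightarrow> 'a)" where
  "hol_bracket bracket (x, \<delta>1) (y, \<delta>2) =
     (bracket x y + \<delta>1 y, commutator (bracket x) \<delta>2 + commutator \<delta>1 \<delta>2)"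

definition in_hol_alg :: "'a set \<Rightarrow> ('a \<times> ('a::ab_group_add \<Rightarrow> 'a)) set" where
  "in_hol_alg S = S \<times> {0}"

definition in_hol_der :: "('a \<Rightarrow> 'a) set \<Rightarrow> ('a::ab_group_add \<times> ('a \<Rightarrow> 'a)) set" where
  "in_hol_der D = {0} \<times> D"

definition left_centralizer :: "('v \<Rightarrow> 'v \<Rightarrow> 'v::zero) \<Rightarrow> 'v set \<Rightarrow> 'v set \<Rightarrow> 'v set" where
  "left_centralizer m L M = {u \<in> L. \<forall>v \<in> M. m u v = 0}"

definition Leib_valued_Der ::
  "('f::field \<Rightarrow> 'a::ab_group_add \<Rightarrow> 'a) \<Rightarrow> ('a \<Rightarrow> 'a \<Rightarrow> 'a) \<Rightarrow> ('a \<Rightarrow> 'a) set" where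
  "Leib_valued_Der scale bracket = {\<delta> \<in> Der scale bracket. range \<delta> \<subseteq> Leib scale bracket}"

text \<open>
  \<open>direct_sum U V\<close> says that the sum \<open>U + V\<close> (of \<open>Set_Algebras\<close>) of two subspaces is direct. It is
  applied to the subspaces of \<open>subspace_left_centralizer\<close> and \<open>subspace_Leib_valued_Der\<close>.
\<close>

definition direct_sum :: "'v::ab_group_add set \<Rightarrow> 'v set \<Rightarrow> bool" where
  "direct_sum U V \<longleftrightarrow>
     (\<forall>u\<in>U. \<forall>u'\<in>U. \<forall>v\<in>V. \<forall>v'\<in>V. u + v = u' + v' \<longrightarrow> u = u' \<and> v = v')"


section \<open>Well-definedness\<close>

context left_leibniz_algebra
begin

sublocale vs: vector_space scale
  using finite_dimensional unfolding finite_dimensional_vector_space_def by blast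

lemmas bracket_simps =
  module_hom.add[OF Vector_Spaces.linear.axioms(3)[OF linear_left]]
  module_hom.add[OF Vector_Spaces.linear.axioms(3)[OF linear_right]]
  module_hom.scale[OF Vector_Spaces.linear.axioms(3)[OF linear_left]]
  module_hom.scale[OF Vector_Spaces.linear.axioms(3)[OF linear_right]]
  module_hom.zero[OF Vector_Spaces.linear.axioms(3)[OF linear_left]]
  module_hom.zero[OF Vector_Spaces.linear.axioms(3)[OF linear_right]]

lemma subspace_Leib: "vs.subspace (Leib scale bracket)"
  unfolding Leib_def by (rule vs.subspace_span)

lemma square_in_Leib: "bracket x x \<in> Leib scale bracket"
  unfolding Leib_def by (rule vs.span_base) simp

lemma symmetric_in_Leib: "bracket x y + bracket y x \<in> Leib scale bracket"
proof -
  have "bracket x y + bracket y x = bracket (x + y) (x + y) - bracket x x - bracket y y"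
    by (simp add: bracket_simps algebra_simps)
  then show ?thesis
    by (metis square_in_Leib subspace_Leib vs.subspace_diff)
qed

lemma bracket_Leib_left: "l \<in> Leib scale bracket \<Longrightarrow> bracket l y = 0"
  unfolding Leib_def
proof (induction rule: vs.span_induct)
  case base
  show ?case
    by (simp add: vs.subspace_def bracket_simps)
next
  case (step l)
  then obtain x where "l = bracket x x" by blast
  then show ?case using left_leibniz[of x x y] by simp
qed

lemma bracket_Leib_right: "l \<in> Leib scale bracket \<Longrightarrow> bracket y l \<in> Leib scale bracket"
  using symmetric_in_Leib[of y l] bracket_Leib_left[of l y] by simp

lemma coset_eq_iff:
  "x +o Leib scale bracket = y +o Leib scale bracket \<longleftrightarrow> x - y \<in> Leib scale bracket"
proof
  assume "x +o Leib scale bracket = y +o Leib scale bracket"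
  moreover have "x \<in> x +o Leib scale bracket"
    using vs.subspace_0[OF subspace_Leib] by (force simp: elt_set_plus_def)
  ultimately show "x - y \<in> Leib scale bracket"
    by (auto simp: elt_set_plus_def)
next
  assume *: "x - y \<in> Leib scale bracket"
  have "x + l = y + ((x - y) + l)" "y + l = x + (l - (x - y))" for l
    by simp_all
  then show "x +o Leib scale bracket = y +o Leib scale bracket"
    unfolding elt_set_plus_def
    using * vs.subspace_add[OF subspace_Leib] vs.subspace_diff[OF subspace_Leib] by blast
qed

lemma leib_quot_bracket_coset:
  "leib_quot_bracket scale bracket (x +o Leib scale bracket) (y +o Leib scale bracket) =
   bracket x y +o Leib scale bracket"
proof -
  have "bracket (x + l) (y + l') +o Leib scale bracket = bracket x y +o Leib scale bracket"
    if "l \<in> Leib scale bracket" "l' \<in> Leib scale bracket" for l l'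
    using that
    by (simp add: coset_eq_iff bracket_simps bracket_Leib_left bracket_Leib_right)
  moreover have "0 \<in> Leib scale bracket"
    by (rule vs.subspace_0[OF subspace_Leib])
  ultimately show ?thesis
    unfolding leib_quot_bracket_def elt_set_plus_def[of x] elt_set_plus_def[of y]
    by (fastforce intro: exI[of _ "0"])
qed

lemma leib_quot_bracket_self:
  assumes "X \<in> leib_quot scale bracket"
  shows "leib_quot_bracket scale bracket X X = Leib scale bracket"
proof -
  obtain x where X: "X = x +o Leib scale bracket"
    using assms unfolding leib_quot_def by blast
  have "bracket x x +o Leib scale bracket = 0 +o Leib scale bracket"
    unfolding coset_eq_iff using square_in_Leib[of x] by simp
  moreover have "0 +o Leib scale bracket = Leib scale bracket"
    by (simp add: elt_set_plus_def)
  ultimately show ?thesis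
    unfolding X leib_quot_bracket_coset by (rule trans)
qed

lemma left_mult_in_Der: "bracket x \<in> Der scale bracket"
  unfolding Der_def using linear_right[of x] left_leibniz[of x] by blast

sublocale hol: vector_space "hol_scale scale"
  by unfold_locales (auto simp: hol_scale_def prod_eq_iff fun_eq_iff algebra_simps)

lemma Der_iff:
  "\<delta> \<in> Der scale bracket \<longleftrightarrow>
     (\<forall>x y. \<delta> (x + y) = \<delta> x + \<delta> y) \<and> (\<forall>c x. \<delta> (scale c x) = scale c (\<delta> x)) \<and>
     (\<forall>x y. \<delta> (bracket x y) = bracket (\<delta> x) y + bracket x (\<delta> y))"
  by (auto simp: Der_def Vector_Spaces.linear_iff vs.vector_space_axioms)

lemma Der_add: "\<delta> \<in> Der scale bracket \<Longrightarrow> \<epsilon> \<in> Der scale bracket \<Longrightarrow> \<delta> + \<epsilon> \<in> Der scale bracket"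
  by (simp add: Der_iff bracket_simps algebra_simps)

lemma Der_scale: "\<delta> \<in> Der scale bracket \<Longrightarrow> (\<lambda>y. scale c (\<delta> y)) \<in> Der scale bracket"
  by (simp add: Der_iff bracket_simps algebra_simps)

lemma Der_zero: "0 \<in> Der scale bracket"
  by (simp add: Der_iff bracket_simps)

lemma Der_at_0: "\<delta> \<in> Der scale bracket \<Longrightarrow> \<delta> 0 = 0"
  using module_hom.zero[OF Vector_Spaces.linear.axioms(3)] by (auto simp: Der_def)

lemma Der_diff: "\<delta> \<in> Der scale bracket \<Longrightarrow> \<delta> (x - y) = \<delta> x - \<delta> y"
  using module_hom.diff[OF Vector_Spaces.linear.axioms(3)] by (auto simp: Der_def)

lemmas bracket_diff =
  module_hom.diff[OF Vector_Spaces.linear.axioms(3)[OF linear_left]]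
  module_hom.diff[OF Vector_Spaces.linear.axioms(3)[OF linear_right]]

lemma Der_commutator:
  assumes "\<delta> \<in> Der scale bracket" "\<epsilon> \<in> Der scale bracket"
  shows "commutator \<delta> \<epsilon> \<in> Der scale bracket"
proof -
  have "\<delta> (x + y) = \<delta> x + \<delta> y" "\<epsilon> (x + y) = \<epsilon> x + \<epsilon> y"
    "\<delta> (scale c x) = scale c (\<delta> x)" "\<epsilon> (scale c x) = scale c (\<epsilon> x)"
    "\<delta> (bracket x y) = bracket (\<delta> x) y + bracket x (\<delta> y)"
    "\<epsilon> (bracket x y) = bracket (\<epsilon> x) y + bracket x (\<epsilon> y)" for x y c
    using assms by (simp_all add: Der_iff)
  then show ?thesis
    by (simp add: Der_iff commutator_def bracket_diff algebra_simps)
qed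

lemma hol_bracket_closed:
  "u \<in> hol scale bracket \<Longrightarrow> v \<in> hol scale bracket \<Longrightarrow> hol_bracket bracket u v \<in> hol scale bracket"
  by (cases u; cases v) (simp add: hol_def Der_add Der_commutator left_mult_in_Der)

lemma hol_left_leibniz:
  assumes "u \<in> hol scale bracket" "v \<in> hol scale bracket" "w \<in> hol scale bracket"
  shows "hol_bracket bracket u (hol_bracket bracket v w) =
         hol_bracket bracket (hol_bracket bracket u v) w +
         hol_bracket bracket v (hol_bracket bracket u w)"
proof -
  obtain x a y b z c where uvw: "u = (x, a)" "v = (y, b)" "w = (z, c)"
    by (cases u; cases v; cases w)
  have D: "a \<in> Der scale bracket" "b \<in> Der scale bracket" "c \<in> Der scale bracket"
    using assms by (auto simp: uvw hol_def)
  have E: "f (p + q) = f p + f q" "f (p - q) = f p - f q"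
    "f (bracket p q) = bracket (f p) q + bracket p (f q)" if "f \<in> {a, b, c}" for f p q
    using that D by (auto simp: Der_iff Der_diff)
  have fst: "bracket x (bracket y z + b z) + a (bracket y z + b z) =
    bracket (bracket x y + a y) z + (bracket x (b z) - b (bracket x z) + (a (b z) - b (a z))) +
    (bracket y (bracket x z + a z) + b (bracket x z + a z))"
    by (simp add: E bracket_simps left_leibniz[of x y] algebra_simps)
  have snd: "commutator (bracket x) (commutator (bracket y) c + commutator b c) +
      commutator a (commutator (bracket y) c + commutator b c) =
    commutator (bracket (bracket x y + a y)) c +
      commutator (commutator (bracket x) b + commutator a b) c +
    (commutator (bracket y) (commutator (bracket x) c + commutator a c) +
      commutator b (commutator (bracket x) c + commutator a c))"
    by (rule ext)
      (simp add: commutator_def E bracket_simps bracket_diff left_leibniz[of x y] algebra_simps)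
  show ?thesis
    using fst snd by (simp add: uvw) (simp add: commutator_def)
qed

lemma subspace_hol: "hol.subspace (hol scale bracket)"
  by (auto simp: hol.subspace_def hol_def hol_scale_def Der_add Der_scale Der_zero
      plus_prod_def zero_prod_def)

lemma subspace_left_centralizer:
  "hol.subspace (left_centralizer (hol_bracket bracket) (hol scale bracket) (in_hol_alg UNIV))"
proof -
  have "left_centralizer (hol_bracket bracket) (hol scale bracket) (in_hol_alg UNIV) =
    {u \<in> hol scale bracket. \<forall>y. bracket (fst u) y + snd u y = 0}"
    using Der_at_0[OF left_mult_in_Der] Der_at_0
    by (auto simp: left_centralizer_def in_hol_alg_def hol_def commutator_def fun_eq_iff
        zero_prod_def)
  moreover have "bracket (x + x') y + (d + d') = 0"
    if "bracket x y + d = 0" "bracket x' y + d' = 0" for x x' y d d'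
  proof -
    have "bracket (x + x') y + (d + d') = (bracket x y + d) + (bracket x' y + d')"
      by (simp add: bracket_simps algebra_simps)
    then show ?thesis using that by simp
  qed
  moreover have "bracket (scale c x) y + scale c d = 0" if "bracket x y + d = 0" for c x y d
    using that by (metis bracket_simps(3) vs.scale_right_distrib vs.scale_zero_right)
  ultimately show ?thesis
    using subspace_hol
    by (simp add: hol.subspace_def hol_scale_def bracket_simps(5))
qed

lemma subspace_Leib_valued_Der: "hol.subspace (in_hol_der (Leib_valued_Der scale bracket))"
  using subspace_Leib
  by (auto simp: hol.subspace_def in_hol_der_def Leib_valued_Der_def hol_scale_def vs.subspace_def
      Der_add Der_scale Der_zero image_subset_iff plus_prod_def zero_prod_def)

end

end

theory Submission
  imports Defs
begin

text \<open>
  The left centralizer of the algebra in its holomorph is the graph \<open>{x - L\<^sub>x}\<close>. Hence its sum with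
  \<open>I\<close> is direct, and if \<open>\<delta> - L\<^sub>z\<close> is \<open>Leib\<close>-valued then
  \<open>x + \<delta> = (x + z) + (- z + L\<^sub>z) + (\<delta> - L\<^sub>z)\<close>. Finally, \<open>x\<close> lies in the sum iff \<open>L\<^sub>x \<in> I\<close>, that
  is, iff \<open>x\<close> is central modulo \<open>Leib\<close>.
\<close>

context left_leibniz_algebra
begin

lemma Der_diff_closed:
  assumes "\<delta> \<in> Der scale bracket" "\<epsilon> \<in> Der scale bracket"
  shows "\<delta> - \<epsilon> \<in> Der scale bracket"
proof -
  have "(\<lambda>y. scale (- 1) (\<epsilon> y)) = - \<epsilon>"
    by (simp add: fun_eq_iff)
  then show ?thesis
    using Der_add[OF assms(1) Der_scale[OF assms(2), of "- 1"]] by simp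
qed

text \<open>Bracketing \<open>(x, \<delta>)\<close> with \<open>(y, 0)\<close> leaves only
  commutators with \<open>0\<close> in the second component, and these vanish; the first component
  is zero for all \<open>y\<close> exactly when \<open>\<delta> = - bracket x\<close>.\<close>

lemma left_centralizer_hol_alg:
  "left_centralizer (hol_bracket bracket) (hol scale bracket) (in_hol_alg UNIV) =
   range (\<lambda>x. (x, - bracket x))"
proof -
  have "commutator (bracket x) 0 = 0" for x
    by (simp add: commutator_def fun_eq_iff bracket_simps)
  moreover have "commutator \<delta> 0 = 0" if "\<delta> \<in> Der scale bracket" for \<delta>
    using Der_at_0[OF that] by (simp add: commutator_def fun_eq_iff)
  moreover have "- bracket x \<in> Der scale bracket" for x
    using Der_diff_closed[OF Der_zero left_mult_in_Der[of x]] by simp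
  moreover have "(\<forall>y. bracket x y + \<delta> y = 0) \<longleftrightarrow> \<delta> = - bracket x" for x \<delta>
    by (auto simp: fun_eq_iff add_eq_0_iff)
  ultimately show ?thesis
    by (auto simp: left_centralizer_def in_hol_alg_def hol_def zero_prod_def)
qed

lemma left_centralizer_plus_in_hol_der:
  "left_centralizer (hol_bracket bracket) (hol scale bracket) (in_hol_alg UNIV) + in_hol_der D =
   {(x, \<epsilon> - bracket x) | x \<epsilon>. \<epsilon> \<in> D}"
  unfolding left_centralizer_hol_alg
  by (force simp: set_plus_def in_hol_der_def plus_prod_def)

text \<open>The first component of a sum comes from the centralizer summand alone and determines it,
  since that summand lies on a graph; the other summand follows by cancellation.\<close>

lemma direct_sum_left_centralizer_in_hol_der:
  "direct_sum (left_centralizer (hol_bracket bracket) (hol scale bracket) (in_hol_alg UNIV))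
     (in_hol_der D)"
  unfolding left_centralizer_hol_alg
  by (auto simp: direct_sum_def in_hol_der_def plus_prod_def)

text \<open>The coset of such an \<open>x\<close> annihilates every coset, so it is central and
  hence the zero coset.\<close>

lemma mem_Leib_if_center_trivial:
  assumes center: "leib_quot_center scale bracket = {Leib scale bracket}"
    and x: "range (bracket x) \<subseteq> Leib scale bracket"
  shows "x \<in> Leib scale bracket"
proof -
  \<comment> \<open>Writing \<open>Leib\<close> as the coset of \<open>0\<close> makes
    \<open>coset_eq_iff\<close> applicable to it.\<close>
  have zero: "0 +o Leib scale bracket = Leib scale bracket"
    by (simp add: elt_set_plus_def)
  have "bracket x y +o Leib scale bracket = Leib scale bracket" for y
    using x coset_eq_iff[of "bracket x y" 0] zero by auto
  then have "x +o Leib scale bracket \<in> leib_quot_center scale bracket"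
    by (auto simp: leib_quot_center_def leib_quot_def leib_quot_bracket_coset)
  then show ?thesis
    using center coset_eq_iff[of x 0] zero by simp
qed

end

theorem theorem4p3:
  fixes scale :: "'f::field \<Rightarrow> 'a::ab_group_add \<Rightarrow> 'a"
    and bracket :: "'a \<Rightarrow> 'a \<Rightarrow> 'a"
  assumes "left_leibniz_algebra scale bracket"
    and "complete_leibniz scale bracket"
  shows "let Z = left_centralizer (hol_bracket bracket) (hol scale bracket) (in_hol_alg UNIV);
             I = in_hol_der (Leib_valued_Der scale bracket)
         in direct_sum Z I \<and>
            hol scale bracket = in_hol_alg UNIV + (Z + I) \<and>
            in_hol_alg UNIV \<inter> (Z + I) = in_hol_alg (Leib scale bracket)"
proof -
  interpret left_leibniz_algebra scale bracket by fact
  define I where "I = Leib_valued_Der scale bracket"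
  define S where
    "S = left_centralizer (hol_bracket bracket) (hol scale bracket) (in_hol_alg UNIV) + in_hol_der I"
  have S: "S = {(x, \<epsilon> - bracket x) | x \<epsilon>. \<epsilon> \<in> I}"
    unfolding S_def by (rule left_centralizer_plus_in_hol_der)
  have "hol scale bracket \<subseteq> in_hol_alg UNIV + S"
  proof
    fix u assume "u \<in> hol scale bracket"
    then obtain x \<delta> where u: "u = (x, \<delta>)" and \<delta>: "\<delta> \<in> Der scale bracket"
      by (auto simp: hol_def)
    then obtain z where "range (\<delta> - bracket z) \<subseteq> Leib scale bracket"
      using assms(2) by (auto simp: complete_leibniz_def inner_derivation_def)
    then have "\<delta> - bracket z \<in> I"
      using Der_diff_closed[OF \<delta> left_mult_in_Der] by (simp add: I_def Leib_valued_Der_def)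
    \<comment> \<open>The first component \<open>- z\<close> is chosen so that the two
      multiplications by \<open>z\<close> cancel, leaving \<open>\<delta>\<close>.\<close>
    then have "(- z, (\<delta> - bracket z) - bracket (- z)) \<in> S"
      unfolding S by blast
    moreover have "(\<delta> - bracket z) - bracket (- z) = \<delta>"
      using bracket_diff(1)[of 0 z] by (simp add: fun_eq_iff bracket_simps)
    ultimately have "(x + z, 0) + (- z, \<delta>) \<in> in_hol_alg UNIV + S"
      by (intro set_plus_intro) (auto simp: in_hol_alg_def)
    then show "u \<in> in_hol_alg UNIV + S"
      by (simp add: u plus_prod_def)
  qed
  moreover have "in_hol_alg UNIV + S \<subseteq> hol scale bracket"
    using Der_diff_closed[OF _ left_mult_in_Der]
    by (auto simp: S set_plus_def in_hol_alg_def hol_def I_def Leib_valued_Der_def plus_prod_def)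
  moreover have "in_hol_alg UNIV \<inter> S = in_hol_alg (Leib scale bracket)"
  proof -
    \<comment> \<open>A pair \<open>(x, \<epsilon> - bracket x)\<close> lies in the algebra exactly
      when \<open>\<epsilon> = bracket x\<close>.\<close>
    have "bracket x \<in> I \<longleftrightarrow> x \<in> Leib scale bracket" for x
    proof
      assume "bracket x \<in> I"
      then show "x \<in> Leib scale bracket"
        using assms(2) mem_Leib_if_center_trivial
        by (simp add: I_def Leib_valued_Der_def complete_leibniz_def)
    next
      assume "x \<in> Leib scale bracket"
      \<comment> \<open>Left multiplication by an element of \<open>Leib\<close> is zero, so its
        range is \<open>{0}\<close>.\<close>
      then show "bracket x \<in> I"
        using left_mult_in_Der[of x] bracket_Leib_left[of x] vs.subspace_0[OF subspace_Leib]
        by (auto simp: I_def Leib_valued_Der_def)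
    qed
    then show ?thesis
      by (auto simp: S in_hol_alg_def)
  qed
  ultimately show ?thesis
    using direct_sum_left_centralizer_in_hol_der[of I]
    unfolding Let_def S_def I_def by blast
qed

end
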